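(* Let $G$ be a graph of order $n$. Then $$\sigma_1(G)+\sigma_1(\overline{G})\ \ge\ \frac{n(n-1)}{2},$$ with equality if and only if $G$ is isomorphic to $K_n$ or to $\overline{K_n}$.
   Context: All graphs are finite, simple and undirected, with nonempty vertex set; the order of a graph is its number of vertices. $\overline{G}$ denotes the complement of $G$ (same vertex set, two distinct vertices being adjacent in $\overline{G}$ iff they are not adjacent in $G$). $K_n$ is the complete graph on $n$ vertices, so $\overline{K_n}$ is the edgeless graph on $n$ vertices. A subset $S\subseteq V(G)$ is called a $1$-nearly independent vertex subset of $G$ if the subgraph of $G$ induced by $S$ contains exactly one edge; $\sigma_1(G)$ denotes the number of $1$-nearly independent vertex subsets of $G$. *)

theory Defs
  imports Complex_Main
begin

type_synonym 'a ugraph = "'a set \<times> 'a set set"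

abbreviation verts :: "'a ugraph \<Rightarrow> 'a set" where
  "verts \<equiv> fst"

abbreviation edges :: "'a ugraph \<Rightarrow> 'a set set" where
  "edges \<equiv> snd"

definition simple_graph :: "'a ugraph \<Rightarrow> bool" where
  "simple_graph G \<longleftrightarrow> finite (verts G) \<and> verts G \<noteq> {} \<and>
     (\<forall>e \<in> edges G. e \<subseteq> verts G \<and> card e = 2)"

definition order :: "'a ugraph \<Rightarrow> nat" where
  "order G = card (verts G)"

definition complement :: "'a ugraph \<Rightarrow> 'a ugraph" where
  "complement G = (verts G,
     {{u, v} | u v. u \<in> verts G \<and> v \<in> verts G \<and> u \<noteq> v \<and> {u, v} \<notin> edges G})"

definition complete_graph :: "nat \<Rightarrow> nat ugraph" where
  "complete_graph n = ({..<n}, {{u, v} | u v. u < n \<and> v < n \<and> u \<noteq> v})"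

definition isomorphic :: "'a ugraph \<Rightarrow> 'b ugraph \<Rightarrow> bool" where
  "isomorphic G H \<longleftrightarrow> (\<exists>f. bij_betw f (verts G) (verts H) \<and>
     (\<forall>u \<in> verts G. \<forall>v \<in> verts G. {u, v} \<in> edges G \<longleftrightarrow> {f u, f v} \<in> edges H))"

definition induced_subgraph :: "'a ugraph \<Rightarrow> 'a set \<Rightarrow> 'a ugraph" where
  "induced_subgraph G S = (S, {e \<in> edges G. e \<subseteq> S})"

definition one_nearly_independent :: "'a ugraph \<Rightarrow> 'a set \<Rightarrow> bool" where
  "one_nearly_independent G S \<longleftrightarrow>
     S \<subseteq> verts G \<and> card (edges (induced_subgraph G S)) = 1"

definition sigma1 :: "'a ugraph \<Rightarrow> nat" where
  "sigma1 G = card {S. one_nearly_independent G S}"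

end

theory Submission
  imports Defs
begin

text \<open>
  Every pair of vertices induces exactly one edge in either the graph or its complement, which
  gives the lower bound. If the graph has both an edge and a non-edge, then some vertex \<open>u\<close> has a
  neighbour \<open>v\<close> and a non-neighbour \<open>w\<close>; the triple \<open>{u, v, w}\<close> induces one or two edges, so it is
  counted as well, in the graph or in its complement.
\<close>

section \<open>Vertex pairs and the edges of the complement\<close>

definition vertex_pairs :: "'a ugraph \<Rightarrow> 'a set set" where
  "vertex_pairs G = {e. e \<subseteq> verts G \<and> card e = 2}"

lemma finite_vertex_pairs: "simple_graph G \<Longrightarrow> finite (vertex_pairs G)"
  by (simp add: simple_graph_def vertex_pairs_def)

lemma edges_subset_vertex_pairs: "simple_graph G \<Longrightarrow> edges G \<subseteq> vertex_pairs G"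
  by (auto simp: simple_graph_def vertex_pairs_def)

lemma card_vertex_pairs: "simple_graph G \<Longrightarrow> card (vertex_pairs G) = order G choose 2"
  by (simp add: simple_graph_def vertex_pairs_def order_def n_subsets)

lemma pair_in_vertex_pairs:
  "{u, v} \<in> vertex_pairs G \<longleftrightarrow> u \<in> verts G \<and> v \<in> verts G \<and> u \<noteq> v"
  by (auto simp: vertex_pairs_def card_2_iff doubleton_eq_iff)

lemma verts_complement [simp]: "verts (complement G) = verts G"
  by (simp add: complement_def)

lemma vertex_pairs_complement [simp]: "vertex_pairs (complement G) = vertex_pairs G"
  by (simp add: vertex_pairs_def)

lemma edges_complement: "edges (complement G) = vertex_pairs G - edges G"
  by (auto simp: complement_def vertex_pairs_def card_2_iff)

lemma simple_graph_complement: "simple_graph G \<Longrightarrow> simple_graph (complement G)"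
  by (auto simp: simple_graph_def edges_complement vertex_pairs_def)

section \<open>Edges and triples as 1-nearly independent sets\<close>

lemma one_nearly_independent_iff:
  "one_nearly_independent G S \<longleftrightarrow> S \<subseteq> verts G \<and> (\<exists>e. {e' \<in> edges G. e' \<subseteq> S} = {e})"
  by (simp add: one_nearly_independent_def induced_subgraph_def card_1_singleton_iff)

lemma finite_one_nearly_independent:
  "simple_graph G \<Longrightarrow> finite {S. one_nearly_independent G S}"
  by (rule finite_subset[of _ "Pow (verts G)"])
    (auto simp: simple_graph_def one_nearly_independent_def)

text \<open>An edge inside the edge \<open>e\<close> coincides with it, since both have two
  elements. Applied to \<open>G\<close> and to its complement, this already counts every vertex pair
  once.\<close>

lemma one_nearly_independent_edge:
  assumes "simple_graph G" and "e \<in> edges G"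
  shows "one_nearly_independent G e"
proof -
  have "e' = e" if "e' \<in> edges G" "e' \<subseteq> e" for e'
    using assms that unfolding simple_graph_def
    by (metis card_subset_eq finite_subset)
  then have "{e' \<in> edges G. e' \<subseteq> e} = {e}" using assms(2) by auto
  then show ?thesis
    using assms by (auto simp: one_nearly_independent_iff simple_graph_def)
qed

lemma card_edges_le_sigma1: "simple_graph G \<Longrightarrow> card (edges G) \<le> sigma1 G"
  unfolding sigma1_def
  by (rule card_mono[OF finite_one_nearly_independent]) (auto intro: one_nearly_independent_edge)

text \<open>Only three pairs fit into the triple, and the hypotheses exclude two of them.\<close>

lemma one_nearly_independent_triple:
  assumes G: "simple_graph G" and "{u, v} \<in> edges G" and "w \<in> verts G"
    and "{u, w} \<notin> edges G" and "{v, w} \<notin> edges G"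
  shows "one_nearly_independent G {u, v, w}"
proof -
  have "e = {u, v}" if "e \<in> edges G" "e \<subseteq> {u, v, w}" for e
  proof -
    have "card e = 2" using that G by (auto simp: simple_graph_def)
    then obtain a b where "e = {a, b}" "a \<noteq> b" by (auto simp: card_2_iff)
    then show ?thesis using that assms(4,5) by (auto simp: insert_commute)
  qed
  then have "{e \<in> edges G. e \<subseteq> {u, v, w}} = {{u, v}}" using assms(2) by blast
  moreover have "{u, v} \<subseteq> verts G" using assms(1,2) by (auto simp: simple_graph_def)
  ultimately show ?thesis using assms(3) unfolding one_nearly_independent_iff by blast
qed

text \<open>The triple is counted by \<open>sigma1\<close> but, having three elements, is not an
  edge; so the edges form a proper subset of the counted sets.\<close>

lemma card_edges_less_sigma1:
  assumes G: "simple_graph G" and "{u, v} \<in> edges G" and "w \<in> verts G"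
    and "w \<noteq> u" and "w \<noteq> v" and "{u, w} \<notin> edges G" and "{v, w} \<notin> edges G"
  shows "card (edges G) < sigma1 G"
  unfolding sigma1_def
proof (rule psubset_card_mono[OF finite_one_nearly_independent[OF G]])
  have "u \<noteq> v" using G assms(2) by (force simp: simple_graph_def)
  then have "card {u, v, w} = 3" using assms(4,5) by simp
  then have "{u, v, w} \<notin> edges G" using G by (auto simp: simple_graph_def)
  moreover have "one_nearly_independent G {u, v, w}"
    by (rule one_nearly_independent_triple[OF G assms(2,3,6,7)])
  ultimately show "edges G \<subset> {S. one_nearly_independent G S}"
    using one_nearly_independent_edge[OF G] by blast
qed

section \<open>Strict inequality when both an edge and a non-edge exist\<close>

lemma card_edges_complement:
  assumes "simple_graph G"
  shows "card (edges G) + card (edges (complement G)) = order G choose 2"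
  using assms card_mono[OF finite_vertex_pairs edges_subset_vertex_pairs[of G]]
  by (simp add: edges_complement card_Diff_subset finite_subset[OF edges_subset_vertex_pairs]
      finite_vertex_pairs edges_subset_vertex_pairs flip: card_vertex_pairs)

text \<open>Compare an edge \<open>{a, b}\<close> with a non-edge \<open>{c, d}\<close> through the
  pair \<open>{a, c}\<close>. If it is an edge, \<open>c\<close> has the neighbour \<open>a\<close>
  and the non-neighbour \<open>d\<close>; otherwise \<open>a\<close> has the neighbour
  \<open>b\<close> and, when \<open>c\<close> differs from \<open>a\<close>, the non-neighbour
  \<open>c\<close>.\<close>

lemma exists_neighbour_and_non_neighbour:
  assumes G: "simple_graph G" and "edges G \<noteq> {}" and "edges G \<noteq> vertex_pairs G"
  obtains u v w where "{u, v} \<in> edges G" "w \<in> verts G" "w \<noteq> u" "w \<noteq> v" "{u, w} \<notin> edges G"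
proof -
  note sub = edges_subset_vertex_pairs[OF G]
  obtain e where e: "e \<in> edges G" using assms(2) by auto
  obtain f where f: "f \<in> vertex_pairs G" "f \<notin> edges G" using assms(3) sub by auto
  obtain a b where ab: "e = {a, b}"
    using e sub by (auto simp: vertex_pairs_def card_2_iff)
  obtain c d where cd: "f = {c, d}" using f(1) by (auto simp: vertex_pairs_def card_2_iff)
  have cdV: "c \<in> verts G" "d \<in> verts G" "c \<noteq> d" 
    using f(1) by (simp_all add: cd pair_in_vertex_pairs)
  have E: "{a, b} \<in> edges G" "{c, d} \<notin> edges G"
    using e f(2) ab cd by simp_all
  show thesis
  proof (cases "{a, c} \<in> edges G")
    case True
    then have "{c, a} \<in> edges G" by (simp add: insert_commute)
    moreover have "d \<noteq> a" using E(2) \<open>{c, a} \<in> edges G\<close> by blast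
    ultimately show thesis using that[of c a d] E(2) cdV by blast
  next
    case False
    show thesis
    proof (cases "c = a")
      \<comment> \<open>Here \<open>{a, c}\<close> is a singleton, so \<open>c\<close> cannot serve
        as a non-neighbour of \<open>a\<close>; the other end \<open>d\<close> of the non-edge
        replaces it.\<close>
      case True
      then have "d \<noteq> b" using E by blast
      then show thesis using that[of a b d] E cdV True by blast
    next
      case False
      moreover have "c \<noteq> b" using E(1) \<open>{a, c} \<notin> edges G\<close> by blast
      ultimately show thesis using that[of a b c] E(1) cdV \<open>{a, c} \<notin> edges G\<close> by blast
    qed
  qed
qed

lemma sigma1_sum_greater:
  assumes G: "simple_graph G" and "edges G \<noteq> {}" and "edges G \<noteq> vertex_pairs G"
  shows "order G choose 2 < sigma1 G + sigma1 (complement G)"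
proof -
  note cG = simple_graph_complement[OF G]
  obtain u v w where uvw: "{u, v} \<in> edges G" "w \<in> verts G" "w \<noteq> u" "w \<noteq> v" "{u, w} \<notin> edges G"
    using exists_neighbour_and_non_neighbour[OF assms] .
  have V: "u \<in> verts G" "v \<in> verts G" using uvw(1) G by (auto simp: simple_graph_def)
  have "u \<noteq> v" using G uvw(1) by (force simp: simple_graph_def)
  \<comment> \<open>The third pair \<open>{v, w}\<close> decides which side gains the triple: if it
    is an edge of \<open>G\<close>, the triple induces only \<open>{u, w}\<close> in the complement;
    if not, it induces only \<open>{u, v}\<close> in \<open>G\<close>.\<close>
  have "card (edges G) < sigma1 G \<or> card (edges (complement G)) < sigma1 (complement G)"
  proof (cases "{v, w} \<in> edges G")
    case True
    then have "card (edges (complement G)) < sigma1 (complement G)"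
      using uvw V \<open>u \<noteq> v\<close>
      by (intro card_edges_less_sigma1[OF cG, of u w v])
        (auto simp: edges_complement pair_in_vertex_pairs insert_commute)
    then show ?thesis ..
  next
    case False
    then show ?thesis using card_edges_less_sigma1[OF G] uvw by blast
  qed
  then show ?thesis
    using card_edges_le_sigma1[OF G] card_edges_le_sigma1[OF cG] card_edges_complement[OF G]
    by linarith
qed

section \<open>The extremal graphs\<close>

lemma sigma1_edgeless: "edges G = {} \<Longrightarrow> sigma1 G = 0"
  by (simp add: sigma1_def one_nearly_independent_iff)

lemma sigma1_complete:
  assumes G: "simple_graph G" and E: "edges G = vertex_pairs G"
  shows "sigma1 G = order G choose 2"
proof -
  have "one_nearly_independent G S \<longleftrightarrow> S \<in> edges G" for S
  proof
    assume S: "one_nearly_independent G S"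
    then obtain e where SV: "S \<subseteq> verts G" and e: "{e' \<in> edges G. e' \<subseteq> S} = {e}"
      unfolding one_nearly_independent_iff by blast
    have uniq: "e' = e" if "e' \<subseteq> S" "card e' = 2" for e'
    proof -
      have "e' \<in> edges G" using that SV by (auto simp: E vertex_pairs_def)
      then show ?thesis using that e by blast
    qed
    from e have "e \<in> edges G" "e \<subseteq> S" by blast+
    then obtain a b where ab: "e = {a, b}" "a \<noteq> b" by (auto simp: E vertex_pairs_def card_2_iff)
    \<comment> \<open>A vertex \<open>x\<close> of \<open>S\<close> outside \<open>e\<close> would
      make \<open>{a, x}\<close> a second edge inside \<open>S\<close>, as all vertex pairs are
      edges.\<close>
    have "S \<subseteq> e"
    proof
      fix x assume "x \<in> S"
      show "x \<in> e"
        using uniq[of "{a, x}"] ab \<open>x \<in> S\<close> \<open>e \<subseteq> S\<close> by (cases "x = a") auto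
    qed
    then show "S \<in> edges G" using \<open>e \<in> edges G\<close> \<open>e \<subseteq> S\<close> by auto
  qed (rule one_nearly_independent_edge[OF G])
  then show ?thesis using card_vertex_pairs[OF G] by (simp add: sigma1_def E)
qed

text \<open>In either extremal case one of the two graphs is complete and contributes the whole
  binomial coefficient, while the other is edgeless and contributes zero.\<close>

lemma sigma1_sum_eq_iff:
  assumes G: "simple_graph G"
  shows "sigma1 G + sigma1 (complement G) = order G choose 2 \<longleftrightarrow>
    edges G = vertex_pairs G \<or> edges G = {}"
proof
  assume "sigma1 G + sigma1 (complement G) = order G choose 2"
  then show "edges G = vertex_pairs G \<or> edges G = {}"
    using sigma1_sum_greater[OF G] by fastforce
next
  have "order (complement G) = order G" by (simp add: order_def)
  moreover assume "edges G = vertex_pairs G \<or> edges G = {}"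
  ultimately show "sigma1 G + sigma1 (complement G) = order G choose 2"
    using sigma1_complete[OF G] sigma1_complete[OF simple_graph_complement[OF G]]
      sigma1_edgeless[of G] sigma1_edgeless[of "complement G"]
    by (auto simp: edges_complement)
qed

section \<open>Isomorphism with the complete and the edgeless graph\<close>

lemma verts_complete_graph [simp]: "verts (complete_graph n) = {..<n}"
  by (simp add: complete_graph_def)

lemma edges_complete_graph: "edges (complete_graph n) = vertex_pairs (complete_graph n)"
  by (auto simp: complete_graph_def vertex_pairs_def card_2_iff)

lemma isomorphic_complete_graph_iff:
  assumes G: "simple_graph G"
  shows "isomorphic G (complete_graph (order G)) \<longleftrightarrow> edges G = vertex_pairs G"
proof
  assume "isomorphic G (complete_graph (order G))"
  then obtain f where f: "bij_betw f (verts G) {..<order G}"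
    and E: "\<And>u v. u \<in> verts G \<Longrightarrow> v \<in> verts G \<Longrightarrow>
      {u, v} \<in> edges G \<longleftrightarrow> {f u, f v} \<in> edges (complete_graph (order G))"
    by (auto simp: isomorphic_def)
  have "{u, v} \<in> edges G" if "u \<in> verts G" "v \<in> verts G" "u \<noteq> v" for u v
  proof -
    have "f u < order G" "f v < order G" "f u \<noteq> f v"
      using f that by (auto simp: bij_betw_def inj_on_def)
    then show ?thesis using E that by (simp add: edges_complete_graph pair_in_vertex_pairs)
  qed
  then show "edges G = vertex_pairs G"
    using edges_subset_vertex_pairs[OF G] by (auto simp: vertex_pairs_def card_2_iff)
next
  assume E: "edges G = vertex_pairs G"
  have "finite (verts G)" using G by (simp add: simple_graph_def)
  then obtain f where f: "bij_betw f (verts G) {..<order G}"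
    unfolding order_def using ex_bij_betw_finite_nat lessThan_atLeast0 by metis
  \<comment> \<open>Membership on each side amounts to distinctness of the two vertices, so
    injectivity of \<open>f\<close> is what remains; this also settles \<open>u = v\<close>, where
    both sides fail.\<close>
  have "{u, v} \<in> edges G \<longleftrightarrow> {f u, f v} \<in> edges (complete_graph (order G))"
    if "u \<in> verts G" "v \<in> verts G" for u v
    using f that unfolding E edges_complete_graph pair_in_vertex_pairs
    by (auto simp: bij_betw_def dest: inj_onD)
  then show "isomorphic G (complete_graph (order G))"
    using f by (auto simp: isomorphic_def)
qed

text \<open>The same bijection serves both sides, because it maps vertex pairs to vertex pairs and
  so preserves non-adjacency whenever it preserves adjacency. This reduces the edgeless case to the
  complete one.\<close>

lemma isomorphic_complement:
  assumes G: "simple_graph G" and H: "simple_graph H"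
  shows "isomorphic G (complement H) \<longleftrightarrow> isomorphic (complement G) H"
proof -
  have "({u, v} \<in> edges G \<longleftrightarrow> {f u, f v} \<in> edges (complement H)) \<longleftrightarrow>
    ({u, v} \<in> edges (complement G) \<longleftrightarrow> {f u, f v} \<in> edges H)"
    if "bij_betw f (verts G) (verts H)" "u \<in> verts G" "v \<in> verts G" for f u v
  proof -
    have "f u \<in> verts H" "f v \<in> verts H" "f u = f v \<longleftrightarrow> u = v"
      using that by (auto simp: bij_betw_def inj_on_def)
    moreover have "{u, v} \<in> edges G \<Longrightarrow> u \<noteq> v" "{f u, f v} \<in> edges H \<Longrightarrow> f u \<noteq> f v"
      using edges_subset_vertex_pairs[OF G] edges_subset_vertex_pairs[OF H]
      by (metis pair_in_vertex_pairs subsetD)+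
    ultimately show ?thesis
      \<comment> \<open>Removing \<open>insert_absorb2\<close> keeps \<open>{u, u}\<close> from
        collapsing to \<open>{u}\<close>, so that \<open>pair_in_vertex_pairs\<close> still applies
        when \<open>u = v\<close>.\<close>
      using that by (auto simp: edges_complement pair_in_vertex_pairs simp del: insert_absorb2)
  qed
  then show ?thesis unfolding isomorphic_def verts_complement by blast
qed

lemma simple_graph_complete_graph: "n > 0 \<Longrightarrow> simple_graph (complete_graph n)"
  by (auto simp: simple_graph_def complete_graph_def)

theorem theorem2:
  fixes G :: "'a ugraph" and n :: nat
  assumes "simple_graph G" and "order G = n"
  shows "real (sigma1 G + sigma1 (complement G)) \<ge> real n * (real n - 1) / 2 \<and>
    (real (sigma1 G + sigma1 (complement G)) = real n * (real n - 1) / 2 \<longleftrightarrow>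
      isomorphic G (complete_graph n) \<or> isomorphic G (complement (complete_graph n)))"
proof -
  note cG = simple_graph_complement[OF assms(1)]
  have "n > 0" using assms by (auto simp: order_def simple_graph_def card_gt_0_iff)
  \<comment> \<open>The case split on \<open>n\<close> reconciles the truncated subtraction in
    \<open>choose_two\<close> with the real one.\<close>
  have choose: "real n * (real n - 1) / 2 = real (n choose 2)"
    by (cases n) (simp_all add: choose_two real_of_nat_div algebra_simps)
  have lower: "n choose 2 \<le> sigma1 G + sigma1 (complement G)"
    using card_edges_complement card_edges_le_sigma1[OF assms(1)] card_edges_le_sigma1[OF cG] assms
    by fastforce
  have "isomorphic G (complete_graph n) \<longleftrightarrow> edges G = vertex_pairs G"
    using isomorphic_complete_graph_iff assms by blast
  \<comment> \<open>Moving the complement over to \<open>G\<close> turns this into the question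
    whether \<open>complement G\<close> is complete, that is, whether \<open>G\<close> has no
    edges.\<close>
  moreover have "isomorphic G (complement (complete_graph n)) \<longleftrightarrow> edges G = {}"
  proof -
    have "order (complement G) = n" using assms(2) by (simp add: order_def)
    then have "isomorphic G (complement (complete_graph n)) \<longleftrightarrow>
      edges (complement G) = vertex_pairs (complement G)"
      using isomorphic_complete_graph_iff[OF cG]
        isomorphic_complement[OF assms(1) simple_graph_complete_graph[OF \<open>n > 0\<close>]] by simp
    then show ?thesis
      using edges_subset_vertex_pairs[OF assms(1)] by (auto simp: edges_complement)
  qed
  ultimately show ?thesis
    unfolding choose of_nat_eq_iff of_nat_le_iff
    using lower sigma1_sum_eq_iff[OF assms(1)] assms(2) by simp
qed

end
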